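(* Let $\mathcal{F}_{2c}$ denote the class of $2$-connected graphs. If $n$ is an even positive integer, then $$M_{\mathcal{F}_{2c}}(n)=2^{n-2}.$$
   Context: All graphs are finite and simple. For two graphs $G,G'$ on the vertex set $[n]=\{1,\dots,n\}$, $G\oplus G'$ denotes the graph on $[n]$ whose edge set is the symmetric difference of $E(G)$ and $E(G')$. For a class $\mathcal{F}$ of graphs, a family $\mathcal{G}$ of (labeled) graphs on vertex set $[n]$ is called $\mathcal{F}$-good if $G\oplus G'\in\mathcal{F}$ for any two distinct members $G,G'\in\mathcal{G}$. $M_{\mathcal{F}}(n)$ denotes the maximum possible size of an $\mathcal{F}$-good family on vertex set $[n]$. A graph is $k$-connected if it has more than $k$ vertices and remains connected after the deletion of any fewer than $k$ vertices. *)

theory Defs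
  imports Main
begin

record 'a graph =
  verts :: "'a set"
  edges :: "'a set set"

definition simple_graph :: "'a graph \<Rightarrow> bool" where
  "simple_graph G \<longleftrightarrow> finite (verts G) \<and> edges G \<subseteq> {e. e \<subseteq> verts G \<and> card e = 2}"

definition adj_rel :: "'a graph \<Rightarrow> ('a \<times> 'a) set" where
  "adj_rel G = {(u, v). {u, v} \<in> edges G}"

definition connected_graph :: "'a graph \<Rightarrow> bool" where
  "connected_graph G \<longleftrightarrow> verts G \<noteq> {} \<and> (\<forall>u\<in>verts G. \<forall>v\<in>verts G. (u, v) \<in> (adj_rel G)\<^sup>*)"

definition delete_verts :: "'a graph \<Rightarrow> 'a set \<Rightarrow> 'a graph" where
  "delete_verts G S = \<lparr>verts = verts G - S, edges = {e \<in> edges G. e \<inter> S = {}}\<rparr>"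

definition k_connected :: "nat \<Rightarrow> 'a graph \<Rightarrow> bool" where
  "k_connected k G \<longleftrightarrow> simple_graph G \<and> card (verts G) > k \<and>
     (\<forall>S \<subseteq> verts G. card S < k \<longrightarrow> connected_graph (delete_verts G S))"

definition graphs_on :: "nat \<Rightarrow> nat graph set" where
  "graphs_on n = {G. simple_graph G \<and> verts G = {1..n}}"

text \<open>Only used for graphs with the same vertex set.\<close>

definition graph_xor :: "'a graph \<Rightarrow> 'a graph \<Rightarrow> 'a graph" (infixl "\<oplus>\<^sub>G" 65) where
  "G \<oplus>\<^sub>G H = \<lparr>verts = verts G, edges = (edges G - edges H) \<union> (edges H - edges G)\<rparr>"

definition good_family :: "nat graph set \<Rightarrow> nat \<Rightarrow> nat graph set \<Rightarrow> bool" where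
  "good_family F n \<G> \<longleftrightarrow> \<G> \<subseteq> graphs_on n \<and> (\<forall>G\<in>\<G>. \<forall>H\<in>\<G>. G \<noteq> H \<longrightarrow> G \<oplus>\<^sub>G H \<in> F)"

definition max_good :: "nat graph set \<Rightarrow> nat \<Rightarrow> nat" where
  "max_good F n = Max {card \<G> | \<G>. good_family F n \<G>}"

text \<open>The set in \<^term>\<open>max_good F n\<close> is finite and nonempty, so its \<^const>\<open>Max\<close> is
  a genuine maximum, and every \<^term>\<open>card \<G>\<close> in it is the size of a finite set.\<close>

lemma finite_graphs_on: "finite (graphs_on n)"
proof (rule finite_subset)
  show "graphs_on n \<subseteq> (\<lambda>E. \<lparr>verts = {1..n}, edges = E\<rparr>) ` Pow (Pow {1..n})"
  proof
    fix G :: "nat graph" assume "G \<in> graphs_on n"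
    then have "G = \<lparr>verts = {1..n}, edges = edges G\<rparr>" "edges G \<in> Pow (Pow {1..n})"
      by (auto simp: graphs_on_def simple_graph_def)
    then show "G \<in> (\<lambda>E. \<lparr>verts = {1..n}, edges = E\<rparr>) ` Pow (Pow {1..n})"
      by (rule image_eqI)
  qed
qed auto

lemma finite_good_family: "good_family F n \<G> \<Longrightarrow> finite \<G>"
  using finite_graphs_on finite_subset unfolding good_family_def by blast

lemma finite_good_family_cards: "finite {card \<G> | \<G>. good_family F n \<G>}"
proof (rule finite_subset)
  show "{card \<G> | \<G>. good_family F n \<G>} \<subseteq> card ` Pow (graphs_on n)"
    by (auto simp: good_family_def)
  show "finite (card ` Pow (graphs_on n))"
    by (simp add: finite_graphs_on)
qed

lemma max_good_attained: "\<exists>\<G>. good_family F n \<G> \<and> card \<G> = max_good F n"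
proof -
  have "good_family F n {}" by (simp add: good_family_def)
  then have "{card \<G> | \<G>. good_family F n \<G>} \<noteq> {}" by blast
  from Max_in[OF finite_good_family_cards this] show ?thesis
    unfolding max_good_def by auto
qed

lemma card_le_max_good: "good_family F n \<G> \<Longrightarrow> card \<G> \<le> max_good F n"
  unfolding max_good_def by (rule Max_ge[OF finite_good_family_cards]) blast

end

theory Submission
  imports Defs
begin

text \<open>
  Upper bound: fix two vertices \<open>v\<close> and \<open>w\<close>. In a 2-connected graph \<open>v\<close> has a neighbour other
  than \<open>w\<close>, since otherwise deleting \<open>w\<close> would isolate \<open>v\<close>. So two distinct members of a good
  family never have the same neighbours of \<open>v\<close> outside \<open>{v, w}\<close>, and there are only \<open>2 ^ (n - 2)\<close>
  possible sets of such neighbours (\<open>card_good_family_le\<close>). This holds for every \<open>n \<ge> 2\<close>.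

  Lower bound: the cuts of the complete graph, that is, the complete bipartite graphs between a
  vertex set \<open>A\<close> and its complement, are closed under symmetric difference: the cuts of \<open>A\<close> and
  \<open>B\<close> differ in the cut of the symmetric difference of \<open>A\<close> and \<open>B\<close> (\<open>graph_xor_cut\<close>). A complete
  bipartite graph is 2-connected once both sides have at least two vertices (\<open>k_connected_cut\<close>),
  so the cuts to avoid are those with a side of size one. Parity avoids them: the even sets are
  closed under symmetric difference, and as \<open>n\<close> is even, complements of even sets are even. So
  a cut with an even side is either empty or has two sides of size at least two. A set and its
  complement give the same cut, so \<open>A\<close> is chosen without the vertex \<open>n\<close>; the \<open>n - 1\<close> other
  vertices have \<open>2 ^ (n - 2)\<close> even subsets.
\<close>

section \<open>Upper bound\<close>

lemma k_connected_2_neighbour: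
  assumes G: "k_connected 2 G" and v: "v \<in> verts G" and w: "w \<in> verts G" and "v \<noteq> w"
  obtains u where "u \<in> verts G - {v, w}" "{v, u} \<in> edges G"
proof -
  from G have simple: "simple_graph G" and "card (verts G) > 2"
    and conn: "connected_graph (delete_verts G {w})"
    using w by (auto simp: k_connected_def)
  moreover have "card {v, w} \<le> 2"
    by (simp add: card_insert_if)
  ultimately have "\<not> verts G \<subseteq> {v, w}"
    using card_mono[of "{v, w}" "verts G"] by auto
  then obtain x where x: "x \<in> verts G" "x \<noteq> v" "x \<noteq> w"
    by blast
  with v \<open>v \<noteq> w\<close> conn have "(v, x) \<in> (adj_rel (delete_verts G {w}))\<^sup>*"
    by (auto simp: connected_graph_def delete_verts_def)
  with \<open>x \<noteq> v\<close> obtain u where "{v, u} \<in> edges G" "u \<noteq> w"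
    by (auto elim: converse_rtranclE simp: adj_rel_def delete_verts_def)
  moreover from this simple have "u \<in> verts G" "card {v, u} = 2"
    by (auto simp: simple_graph_def)
  moreover from this(2) have "u \<noteq> v"
    by auto
  ultimately show thesis
    using that by blast
qed

lemma card_good_family_le:
  assumes good: "good_family {G. k_connected 2 G} n \<G>"
    and v: "v \<in> {1..n}" and w: "w \<in> {1..n}" and "v \<noteq> w"
  shows "card \<G> \<le> 2 ^ (n - 2)"
proof -
  define N where "N G = {u \<in> {1..n} - {v, w}. {v, u} \<in> edges G}" for G :: "nat graph"
  have "inj_on N \<G>"
  proof (rule inj_onI, rule ccontr)
    fix G H assume GH: "G \<in> \<G>" "H \<in> \<G>" "N G = N H" "G \<noteq> H"
    then have "k_connected 2 (G \<oplus>\<^sub>G H)" and "verts (G \<oplus>\<^sub>G H) = {1..n}"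
      using good by (auto simp: good_family_def graphs_on_def graph_xor_def)
    then obtain u where "u \<in> {1..n} - {v, w}" "{v, u} \<in> edges (G \<oplus>\<^sub>G H)"
      using v w \<open>v \<noteq> w\<close> k_connected_2_neighbour by metis
    with \<open>N G = N H\<close> show False
      by (auto simp: N_def graph_xor_def)
  qed
  moreover have "N ` \<G> \<subseteq> Pow ({1..n} - {v, w})"
    by (auto simp: N_def)
  ultimately have "card \<G> \<le> card (Pow ({1..n} - {v, w}))"
    by (intro card_inj_on_le) auto
  also have "\<dots> = 2 ^ (n - 2)"
    using v w \<open>v \<noteq> w\<close> by (simp add: card_Pow card_Diff_subset)
  finally show ?thesis .
qed

section \<open>Cuts\<close>

definition cut_graph :: "'a set \<Rightarrow> 'a set \<Rightarrow> 'a graph" where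
  "cut_graph V A = \<lparr>verts = V, edges = {{a, b} | a b. a \<in> V \<inter> A \<and> b \<in> V - A}\<rparr>"

lemma verts_cut_graph [simp]: "verts (cut_graph V A) = V"
  by (simp add: cut_graph_def)

lemma pair_in_edges_cut [simp]:
  "{u, v} \<in> edges (cut_graph V A) \<longleftrightarrow> u \<in> V \<and> v \<in> V \<and> (u \<in> A) \<noteq> (v \<in> A)"
  by (auto simp: cut_graph_def doubleton_eq_iff)

lemma simple_graph_cut: "finite V \<Longrightarrow> simple_graph (cut_graph V A)"
  by (auto simp: simple_graph_def cut_graph_def card_2_iff)

lemma graph_xor_cut: "cut_graph V A \<oplus>\<^sub>G cut_graph V B = cut_graph V (sym_diff A B)"
proof -
  have *: "\<exists>u v. e = {u, v}" if "e \<in> edges (cut_graph V C)" for e and C :: "'a set"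
    using that by (auto simp: cut_graph_def)
  have "e \<in> edges (cut_graph V A \<oplus>\<^sub>G cut_graph V B) \<longleftrightarrow> e \<in> edges (cut_graph V (sym_diff A B))" for e
  proof (cases "\<exists>u v. e = {u, v}")
    case True
    then show ?thesis
      by (auto simp: graph_xor_def)
  next
    case False
    then have "e \<notin> edges (cut_graph V C)" for C
      using * by blast
    then show ?thesis
      by (simp add: graph_xor_def)
  qed
  then have "edges (cut_graph V A \<oplus>\<^sub>G cut_graph V B) = edges (cut_graph V (sym_diff A B))"
    by blast
  then show ?thesis
    by (simp add: graph_xor_def cut_graph_def)
qed

text \<open>A vertex \<open>r\<close> that is known to lie outside the side \<open>A\<close> singles \<open>A\<close> out among the two sides:
  \<open>A\<close> is the set of neighbours of \<open>r\<close>.\<close>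

lemma inj_on_cut:
  assumes "r \<in> V"
  shows "inj_on (cut_graph V) (Pow (V - {r}))"
proof (rule inj_onI)
  have nb: "A = {u. {u, r} \<in> edges (cut_graph V A)}" if "A \<in> Pow (V - {r})" for A
    using that assms by auto
  fix A B assume "A \<in> Pow (V - {r})" "B \<in> Pow (V - {r})" "cut_graph V A = cut_graph V B"
  then show "A = B"
    using nb[of A] nb[of B] by simp
qed

text \<open>Fewer than \<open>k\<close> deletions leave a vertex on each side, and a complete bipartite graph with
  two nonempty sides is connected.\<close>

lemma k_connected_cut:
  assumes fin: "finite V" and "A \<subseteq> V" and "0 < k"
    and A: "k \<le> card A" and B: "k \<le> card (V - A)"
  shows "k_connected k (cut_graph V A)"
  unfolding k_connected_def
proof (intro conjI allI impI)
  show "simple_graph (cut_graph V A)"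
    using fin by (rule simple_graph_cut)
  have "card V = card A + card (V - A)"
    using fin \<open>A \<subseteq> V\<close> by (simp add: card_Diff_subset card_mono finite_subset)
  with A B \<open>0 < k\<close> show "k < card (verts (cut_graph V A))"
    by simp
next
  fix S assume "S \<subseteq> verts (cut_graph V A)" and S: "card S < k"
  then have "finite S"
    using fin finite_subset by auto
  then have "\<not> A \<subseteq> S" "\<not> V - A \<subseteq> S"
    using A B S card_mono[of S A] card_mono[of S "V - A"] by linarith+
  then obtain a b where a: "a \<in> A - S" and b: "b \<in> V - A - S"
    by blast
  let ?R = "adj_rel (delete_verts (cut_graph V A) S)"
  have R: "(u, v) \<in> ?R \<longleftrightarrow> u \<in> V - S \<and> v \<in> V - S \<and> (u \<in> A) \<noteq> (v \<in> A)" for u v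
    by (auto simp: adj_rel_def delete_verts_def)
  have "(u, a) \<in> ?R\<^sup>* \<and> (a, u) \<in> ?R\<^sup>*" if u: "u \<in> V - S" for u
  proof (cases "u \<in> A")
    case True
    then have "(u, b) \<in> ?R" "(b, u) \<in> ?R" "(a, b) \<in> ?R" "(b, a) \<in> ?R"
      using a b u \<open>A \<subseteq> V\<close> by (auto simp: R)
    then show ?thesis
      by (meson r_into_rtrancl rtrancl_trans)
  next
    case False
    then have "(u, a) \<in> ?R" "(a, u) \<in> ?R"
      using a u \<open>A \<subseteq> V\<close> by (auto simp: R)
    then show ?thesis
      by blast
  qed
  then have "(u, v) \<in> ?R\<^sup>*" if "u \<in> V - S" "v \<in> V - S" for u v
    using that by (meson rtrancl_trans)
  moreover have "V - S \<noteq> {}"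
    using b by blast
  ultimately show "connected_graph (delete_verts (cut_graph V A) S)"
    by (auto simp: connected_graph_def delete_verts_def)
qed

section \<open>Even sets\<close>

lemma even_card_sym_diff:
  assumes "finite A" "finite B" "even (card A)" "even (card B)"
  shows "even (card (sym_diff A B))"
proof -
  have "card (sym_diff A B) = card (A - B) + card (B - A)"
    using assms by (intro card_Un_disjoint) auto
  moreover have "card A = card (A \<inter> B) + card (A - B)"
    using assms by (simp add: card_Int_Diff)
  moreover have "card B = card (A \<inter> B) + card (B - A)"
    using assms by (metis card_Int_Diff inf_commute)
  ultimately show ?thesis
    using assms by presburger
qed

text \<open>Any subset of \<open>S\<close> becomes even in exactly one way by adding or not adding one further
  element \<open>x\<close>.\<close>

lemma card_even_subsets_insert:
  assumes "finite S" "x \<notin> S"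
  shows "card {A. A \<subseteq> insert x S \<and> even (card A)} = 2 ^ card S"
proof -
  define f where "f B = (if even (card B) then B else insert x B)" for B
  have "bij_betw (\<lambda>A. A - {x}) {A. A \<subseteq> insert x S \<and> even (card A)} (Pow S)"
  proof (rule bij_betw_byWitness[where f' = f])
    have fin: "finite A" if "A \<subseteq> insert x S" for A
      using that assms(1) finite_subset by auto
    then show "\<forall>A\<in>{A. A \<subseteq> insert x S \<and> even (card A)}. f (A - {x}) = A"
      by (auto simp: f_def card_Diff_singleton_if card_gt_0_iff)
    show "\<forall>B\<in>Pow S. f B - {x} = B"
      using assms by (auto simp: f_def)
    show "(\<lambda>A. A - {x}) ` {A. A \<subseteq> insert x S \<and> even (card A)} \<subseteq> Pow S"
      by auto
    have "card (insert x B) = Suc (card B)" if "B \<subseteq> S" for B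
      using that assms finite_subset by (subst card_insert_disjoint) auto
    then show "f ` Pow S \<subseteq> {A. A \<subseteq> insert x S \<and> even (card A)}"
      by (auto simp: f_def)
  qed
  then show ?thesis
    using assms(1) by (simp add: bij_betw_same_card card_Pow)
qed

section \<open>The maximum\<close>

lemma even_cuts_good_family:
  assumes "even n" "n > 0"
  shows "good_family {G. k_connected 2 G} n
    (cut_graph {1..n} ` {A. A \<subseteq> {1..n} - {n} \<and> even (card A)})"
  unfolding good_family_def
proof (intro conjI ballI impI)
  show "cut_graph {1..n} ` {A. A \<subseteq> {1..n} - {n} \<and> even (card A)} \<subseteq> graphs_on n"
    by (auto simp: graphs_on_def simple_graph_cut)
next
  fix G H
  assume "G \<in> cut_graph {1..n} ` {A. A \<subseteq> {1..n} - {n} \<and> even (card A)}"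
    "H \<in> cut_graph {1..n} ` {A. A \<subseteq> {1..n} - {n} \<and> even (card A)}" and "G \<noteq> H"
  then obtain A B where A: "A \<subseteq> {1..n} - {n}" "even (card A)" "G = cut_graph {1..n} A"
    and B: "B \<subseteq> {1..n} - {n}" "even (card B)" "H = cut_graph {1..n} B"
    by blast
  define D where "D = sym_diff A B"
  have D: "D \<subseteq> {1..n} - {n}" "D \<noteq> {}"
    using A B \<open>G \<noteq> H\<close> by (auto simp: D_def)
  have "finite A" "finite B" "finite D"
    using A(1) B(1) D(1) by (auto intro: finite_subset)
  with A B have "even (card D)"
    unfolding D_def by (intro even_card_sym_diff)
  \<comment> \<open>Both sides of the cut of \<open>D\<close> are even and nonempty: the complement contains \<open>n\<close>.\<close>
  have "D \<subseteq> {1..n}"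
    using D(1) by blast
  then have "card ({1..n} - D) = n - card D" "card D \<le> n"
    using card_mono[of "{1..n}" D] \<open>finite D\<close> by (simp_all add: card_Diff_subset)
  then have "even (card ({1..n} - D))"
    using \<open>even n\<close> \<open>even (card D)\<close> by simp
  moreover have "n \<in> {1..n} - D"
    using D(1) \<open>n > 0\<close> by auto
  then have "card ({1..n} - D) \<noteq> 0" "card D \<noteq> 0"
    using D(2) \<open>finite D\<close> by (auto simp del: atLeastAtMost_iff)
  ultimately have "2 \<le> card D" "2 \<le> card ({1..n} - D)"
    using \<open>even (card D)\<close> by presburger+
  then have "k_connected 2 (cut_graph {1..n} D)"
    using D by (intro k_connected_cut) auto
  then show "G \<oplus>\<^sub>G H \<in> {G. k_connected 2 G}"
    using A B by (simp add: graph_xor_cut D_def)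
qed

theorem theorem3:
  fixes n :: nat
  assumes "even n" and "n > 0"
  shows "max_good {G. k_connected 2 G} n = 2 ^ (n - 2)"
proof (rule antisym)
  have "n \<ge> 2"
    using assms by presburger
  obtain \<G> where "good_family {G. k_connected 2 G} n \<G>"
    "card \<G> = max_good {G. k_connected 2 G} n"
    using max_good_attained by blast
  then show "max_good {G. k_connected 2 G} n \<le> 2 ^ (n - 2)"
    using card_good_family_le[of n \<G> n 1] \<open>n \<ge> 2\<close> by simp
  let ?\<A> = "{A. A \<subseteq> {1..n} - {n} \<and> even (card A)}"
  have V: "{1..n} - {n} = insert 1 ({1..n} - {1, n})"
    using \<open>n \<ge> 2\<close> by auto
  have "card ?\<A> = 2 ^ card ({1..n} - {1, n})"
    unfolding V by (rule card_even_subsets_insert) auto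
  also have "card ({1..n} - {1, n}) = n - 2"
    using \<open>n \<ge> 2\<close> by (simp add: card_Diff_subset)
  finally have "card (cut_graph {1..n} ` ?\<A>) = 2 ^ (n - 2)"
    using inj_on_subset[OF inj_on_cut[of n "{1..n}"], of ?\<A>] \<open>n > 0\<close>
    by (subst card_image) auto
  then show "2 ^ (n - 2) \<le> max_good {G. k_connected 2 G} n"
    using card_le_max_good[OF even_cuts_good_family[OF assms]] by simp
qed

end
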